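(* Let $g:\mathbb{R}^m\to\mathbb{R}$ be a convex Fréchet differentiable function with $L_g$-Lipschitz continuous gradient, and assume that $\operatorname{argmin} g\neq\emptyset$. Let $t_0>0$, $u_0,v_0\in\mathbb{R}^m$, $\alpha>3$, $\gamma>0$ and $\beta\in\mathbb{R}$. Let $x:[t_0,+\infty)\to\mathbb{R}^m$ be the unique strong global solution of the dynamical system $$\ddot{x}(t)+\frac{\alpha}{t}\dot{x}(t)+\nabla g\left(x(t)+\left(\gamma+\frac{\beta}{t}\right)\dot{x}(t)\right)=0,\qquad x(t_0)=u_0,\ \dot{x}(t_0)=v_0.$$ Then there exist $K\ge 0$ and $t_1\ge t_0$ such that $$g\left(x(t)+\left(\gamma+\frac{\beta}{t}\right)\dot{x}(t)\right)-\min g\le \frac{K}{t^2}\quad\text{for all }t\ge t_1.$$ Further, $$\int_{t_0}^{+\infty}t\left(g\left(x(t)+\left(\gamma+\frac{\beta}{t}\right)\dot{x}(t)\right)-\min g\right)dt<+\infty$$ and $$\int_{t_0}^{+\infty}t^2\left\|\nabla g\left(x(t)+\left(\gamma+\frac{\beta}{t}\right)\dot{x}(t)\right)\right\|^2dt<+\infty.$$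
   Context: $\mathbb{R}^m$ carries the Euclidean norm $\|\cdot\|$. That $\nabla g$ is $L_g$-Lipschitz means $L_g\ge 0$ and $\|\nabla g(x)-\nabla g(y)\|\le L_g\|x-y\|$ for all $x,y\in\mathbb{R}^m$. A function $x:[t_0,+\infty)\to\mathbb{R}^m$ is a strong global solution of the dynamical system if: (i) $x$ and $\dot x$ are locally absolutely continuous on $[t_0,+\infty)$ (i.e. absolutely continuous on every compact interval $[t_0,T]$, $T>t_0$); (ii) the differential equation holds for almost every $t\ge t_0$; (iii) $x(t_0)=u_0$ and $\dot x(t_0)=v_0$. Under the stated assumptions such a solution exists and is unique. *)

theory Defs
  imports "HOL-Analysis.Analysis"
begin

definition absolutely_continuous_on :: "real set \<Rightarrow> (real \<Rightarrow> 'a::real_normed_vector) \<Rightarrow> bool" where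
  "absolutely_continuous_on S f \<longleftrightarrow>
     (\<forall>\<epsilon>>0. \<exists>\<delta>>0. \<forall>(n::nat) a b.
        (\<forall>i<n. a i \<le> b i \<and> {a i..b i} \<subseteq> S) \<and>
        (\<forall>i<n. \<forall>j<n. i \<noteq> j \<longrightarrow> {a i<..<b i} \<inter> {a j<..<b j} = {}) \<and>
        (\<Sum>i<n. b i - a i) < \<delta>
        \<longrightarrow> (\<Sum>i<n. norm (f (b i) - f (a i))) < \<epsilon>)"

definition locally_absolutely_continuous_from :: "real \<Rightarrow> (real \<Rightarrow> 'a::real_normed_vector) \<Rightarrow> bool" where
  "locally_absolutely_continuous_from t\<^sub>0 f \<longleftrightarrow> (\<forall>T>t\<^sub>0. absolutely_continuous_on {t\<^sub>0..T} f)"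

text \<open>Trajectories live on \<^term>\<open>{t\<^sub>0..}\<close>, so the derivative is one-sided at \<^term>\<open>t\<^sub>0\<close> and
  values of \<^term>\<open>x\<close> to the left of \<^term>\<open>t\<^sub>0\<close> are irrelevant.\<close>

definition time_deriv :: "real \<Rightarrow> (real \<Rightarrow> 'a::real_normed_vector) \<Rightarrow> real \<Rightarrow> 'a" where
  "time_deriv t\<^sub>0 x t = vector_derivative x (at t within {t\<^sub>0..})"

text \<open>Since \<^const>\<open>vector_derivative\<close> is a total function, the existence of the first derivative
  everywhere (implicit in its absolute continuity) and of the second derivative almost
  everywhere is demanded explicitly.\<close>

definition strong_global_solution ::
  "('a::euclidean_space \<Rightarrow> 'a) \<Rightarrow> real \<Rightarrow> real \<Rightarrow> real \<Rightarrow> real \<Rightarrow> 'a \<Rightarrow> 'a \<Rightarrow> (real \<Rightarrow> 'a) \<Rightarrow> bool" where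
  "strong_global_solution grad_g \<alpha> \<beta> \<gamma> t\<^sub>0 u\<^sub>0 v\<^sub>0 x \<longleftrightarrow>
     x differentiable_on {t\<^sub>0..} \<and>
     locally_absolutely_continuous_from t\<^sub>0 x \<and>
     locally_absolutely_continuous_from t\<^sub>0 (time_deriv t\<^sub>0 x) \<and>
     (AE t in lebesgue. t \<ge> t\<^sub>0 \<longrightarrow>
        time_deriv t\<^sub>0 x differentiable (at t within {t\<^sub>0..}) \<and>
        time_deriv t\<^sub>0 (time_deriv t\<^sub>0 x) t + (\<alpha> / t) *\<^sub>R time_deriv t\<^sub>0 x t
          + grad_g (x t + (\<gamma> + \<beta> / t) *\<^sub>R time_deriv t\<^sub>0 x t) = 0) \<and>
     x t\<^sub>0 = u\<^sub>0 \<and> time_deriv t\<^sub>0 x t\<^sub>0 = v\<^sub>0"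

end

theory Submission
  imports Defs
begin

text \<open>
  Write \<open>y = x + (\<gamma> + \<beta>/t) x'\<close> and let \<open>z\<close> minimise \<open>g\<close>. For \<open>2 < b < \<alpha> - 1\<close> the Lyapunov function
  \<open>t\<^sup>2 (g(y) - g(z)) + |b (x - z) + t x'|\<^sup>2 / 2 + b (\<alpha> - 1 - b) |x - z|\<^sup>2 / 2\<close> has derivative at most
  \<open>- (b - 2) t (g(y) - g(z)) - (\<gamma> t\<^sup>2 - C t) |grad g(y)|\<^sup>2\<close>: convexity produces the first term, the implicit
  damping term \<open>\<gamma> x'\<close> produces \<open>\<gamma> t\<^sup>2 |grad g(y)|\<^sup>2\<close>, and the remaining cross term, which is \<open>O(t)\<close> times
  \<open>x' \<bullet> grad g(y)\<close>, is absorbed by \<open>(\<alpha> - 1 - b) t |x'|\<^sup>2\<close> and \<open>C t |grad g(y)|\<^sup>2\<close>. Integrating the inequality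
  from a time after which \<open>\<gamma> t\<^sup>2 - C t \<ge> \<gamma> t\<^sup>2 / 2\<close> yields all three claims.
\<close>

section \<open>Absolute continuity and the fundamental theorem of calculus\<close>

text \<open>Enumerating \<open>I\<close> by a bijection from \<open>{..<card I}\<close> frees the
  definition from numbered families. Tagged cells of a division, or a single point, can then serve
  as indices directly.\<close>

lemma absolutely_continuous_on_finite_family:
  fixes f :: "real \<Rightarrow> 'a::real_normed_vector"
  assumes "absolutely_continuous_on S f" "e > 0"
  shows "\<exists>d>0. \<forall>(I :: 'i set) a b. finite I \<and> (\<forall>i\<in>I. a i \<le> b i \<and> {a i..b i} \<subseteq> S) \<and>
        (\<forall>i\<in>I. \<forall>j\<in>I. i \<noteq> j \<longrightarrow> {a i<..<b i} \<inter> {a j<..<b j} = {}) \<and>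
        (\<Sum>i\<in>I. b i - a i) < d \<longrightarrow> (\<Sum>i\<in>I. norm (f (b i) - f (a i))) < e"
proof -
  obtain d where "d > 0" and d: "\<forall>(n::nat) a b. (\<forall>i<n. a i \<le> b i \<and> {a i..b i} \<subseteq> S) \<and>
        (\<forall>i<n. \<forall>j<n. i \<noteq> j \<longrightarrow> {a i<..<b i} \<inter> {a j<..<b j} = {}) \<and>
        (\<Sum>i<n. b i - a i) < d \<longrightarrow> (\<Sum>i<n. norm (f (b i) - f (a i))) < e"
    using assms(1)[unfolded absolutely_continuous_on_def, THEN spec, THEN mp, OF assms(2)] by blast
  show ?thesis
  proof (intro exI[of _ d] conjI allI impI \<open>d > 0\<close>, elim conjE)
    fix I :: "'i set" and a b
    assume I: "finite I" and ab: "\<forall>i\<in>I. a i \<le> b i \<and> {a i..b i} \<subseteq> S"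
      and disj: "\<forall>i\<in>I. \<forall>j\<in>I. i \<noteq> j \<longrightarrow> {a i<..<b i} \<inter> {a j<..<b j} = {}"
      and sum: "(\<Sum>i\<in>I. b i - a i) < d"
    obtain h where h: "bij_betw h {..<card I} I"
      using ex_bij_betw_nat_finite[OF I] by (auto simp: lessThan_atLeast0)
    have hI: "h i \<in> I" if "i < card I" for i
      using h that by (auto simp: bij_betw_def)
    have hne: "h i \<noteq> h j" if "i < card I" "j < card I" "i \<noteq> j" for i j
      using h that by (auto simp: bij_betw_def inj_on_def)
    have "(\<Sum>i<card I. norm (f (b (h i)) - f (a (h i)))) < e"
    proof (rule d[THEN spec, THEN spec, THEN spec, THEN mp], intro conjI allI impI)
      show "(\<Sum>i<card I. b (h i) - a (h i)) < d"
        using sum sum.reindex_bij_betw[OF h, of "\<lambda>i. b i - a i"] by simp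
    qed (use hI hne ab disj in auto)
    then show "(\<Sum>i\<in>I. norm (f (b i) - f (a i))) < e"
      using sum.reindex_bij_betw[OF h, of "\<lambda>i. norm (f (b i) - f (a i))"] by simp
  qed
qed

text \<open>Intervals of a fine division tagged in the exceptional set lie in an open set of small
  measure, where absolute continuity controls the increments of the function; all other intervals
  are treated as in the fundamental theorem of calculus.\<close>

lemma absolutely_continuous_on_has_integral_derivative:
  fixes f :: "real \<Rightarrow> 'a::banach"
  assumes ac: "absolutely_continuous_on {a..b} f" and "a \<le> b" and N: "negligible N"
    and der: "\<And>t. t \<in> {a..b} - N \<Longrightarrow> (f has_vector_derivative f' t) (at t within {a..b})"
  shows "(f' has_integral (f b - f a)) {a..b}"
proof (rule has_integral_spike[OF N])
  \<comment> \<open>Zeroing the integrand on \<open>N\<close> does not affect the integral, and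
    cells tagged in \<open>N\<close> then contribute only the increment of \<open>f\<close>, however
    large \<open>f'\<close> is there.\<close>
  define h where "h t = (if t \<in> N then 0 else f' t)" for t
  show "f' t = h t" if "t \<in> {a..b} - N" for t
    using that by (simp add: h_def)
  show "(h has_integral (f b - f a)) {a..b}"
    unfolding has_integral box_real[symmetric]
  proof safe
    fix e :: real
    assume "e > 0"
    \<comment> \<open>Half of \<open>e\<close> is spent on cells tagged outside \<open>N\<close>,
      the other half on those tagged in \<open>N\<close>. The summand 1 keeps the denominator
      positive when \<open>a = b\<close>.\<close>
    define e1 where "e1 = e / (2 * (b - a + 1))"
    have "e1 > 0" and e1: "e1 * (b - a) \<le> e / 2"
      using \<open>e > 0\<close> \<open>a \<le> b\<close> by (auto simp: e1_def field_simps)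
    obtain \<delta> where "\<delta> > 0" and \<delta>:
      "\<forall>(I :: (real \<times> real set) set) u v. finite I \<and> (\<forall>i\<in>I. u i \<le> v i \<and> {u i..v i} \<subseteq> {a..b}) \<and>
        (\<forall>i\<in>I. \<forall>j\<in>I. i \<noteq> j \<longrightarrow> {u i<..<v i} \<inter> {u j<..<v j} = {}) \<and>
        (\<Sum>i\<in>I. v i - u i) < \<delta> \<longrightarrow> (\<Sum>i\<in>I. norm (f (v i) - f (u i))) < e / 2"
      using absolutely_continuous_on_finite_family[OF ac half_gt_zero[OF \<open>e > 0\<close>]] by blast
    have "N \<in> sets lebesgue"
      using N by (simp add: negligible_iff_null_sets null_setsD2)
    \<comment> \<open>Outer regularity gives an open cover \<open>U\<close>; as \<open>N\<close> is
      null, the bound on \<open>U - N\<close> carries over to \<open>U\<close> itself.\<close>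
    then obtain U where U: "open U" "N \<subseteq> U" "U - N \<in> lmeasurable" "emeasure lebesgue (U - N) < ennreal \<delta>"
      using sets_lebesgue_outer_open \<open>\<delta> > 0\<close> by blast
    have U_lm: "U \<in> lmeasurable"
      using U N by (metis Diff_partition negligible_imp_measurable fmeasurable.Un)
    have "measure lebesgue U = measure lebesgue (U - N)"
      using N U_lm U(3) by (intro measure_negligible_symdiff[symmetric]) (auto intro: negligible_subset[OF N])
    also have "\<dots> < \<delta>"
      using U(3,4) \<open>\<delta> > 0\<close> by (metis emeasure_eq_measure2 ennreal_less_iff measure_nonneg)
    finally have mU: "measure lebesgue U < \<delta>" .
    have "\<forall>t. \<exists>d>0. (t \<in> N \<longrightarrow> ball t d \<subseteq> U) \<and> (t \<in> {a..b} - N \<longrightarrow>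
         (\<forall>y\<in>{a..b}. norm (y-t) < d \<longrightarrow> norm (f y - f t - (y-t) *\<^sub>R f' t) \<le> e1 * norm (y-t)))"
    proof
      fix t
      consider "t \<in> N" | "t \<in> {a..b} - N" | "t \<notin> N" "t \<notin> {a..b}" by blast
      then show "\<exists>d>0. (t \<in> N \<longrightarrow> ball t d \<subseteq> U) \<and> (t \<in> {a..b} - N \<longrightarrow>
         (\<forall>y\<in>{a..b}. norm (y-t) < d \<longrightarrow> norm (f y - f t - (y-t) *\<^sub>R f' t) \<le> e1 * norm (y-t)))"
      proof cases
        case 1
        then show ?thesis using U(1,2) open_contains_ball by blast
      next
        case 2
        then show ?thesis
          using der[OF 2] \<open>e1 > 0\<close> unfolding has_vector_derivative_def has_derivative_within_alt by blast
      next
        case 3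
        then show ?thesis by (auto intro: exI[of _ 1])
      qed
    qed
    then obtain d where dpos: "\<And>t. 0 < d t" and dN: "\<And>t. t \<in> N \<Longrightarrow> ball t (d t) \<subseteq> U"
      and d: "\<And>t y. \<lbrakk>t \<in> {a..b} - N; y \<in> {a..b}; norm (y-t) < d t\<rbrakk>
                 \<Longrightarrow> norm (f y - f t - (y-t) *\<^sub>R f' t) \<le> e1 * norm (y-t)"
      by metis
    show "\<exists>\<gamma>. gauge \<gamma> \<and> (\<forall>p. p tagged_division_of cbox a b \<and> \<gamma> fine p \<longrightarrow>
            norm ((\<Sum>(x, k)\<in>p. measure lborel k *\<^sub>R h x) - (f b - f a)) < e)"
    proof (rule exI, safe)
      show "gauge (\<lambda>t. ball t (d t))"
        using dpos gauge_ball_dependent by blast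
    next
      fix p
      assume ptag: "p tagged_division_of cbox a b" and finep: "(\<lambda>t. ball t (d t)) fine p"
      have fin: "finite p" using ptag by blast
      have ba: "b - a = (\<Sum>(x,K)\<in>p. Sup K - Inf K)" "f b - f a = (\<Sum>(x,K)\<in>p. f(Sup K) - f(Inf K))"
        using additive_tagged_division_1[where f= "\<lambda>x. x"] additive_tagged_division_1[where f= f]
            \<open>a \<le> b\<close> ptag by auto
      have cell: "\<exists>u v. K = {u..v} \<and> u \<le> t \<and> t \<le> v \<and> {u..v} \<subseteq> {a..b} \<and> {u..v} \<subseteq> ball t (d t)
            \<and> Inf K = u \<and> Sup K = v"
        if "(t, K) \<in> p" for t K
      proof -
        obtain u v where uv: "K = cbox u v" using tagged_division_ofD(4)[OF ptag \<open>(t, K) \<in> p\<close>] by blast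
        moreover have "t \<in> K" "K \<subseteq> cbox a b" using ptag that by blast+
        moreover have "K \<subseteq> ball t (d t)" using finep that by blast
        ultimately show ?thesis by (auto intro!: exI[of _ u] exI[of _ v])
      qed
      define B where "B = {z \<in> p. fst z \<in> N}"
      have B: "B \<subseteq> p" "finite B" using fin by (auto simp: B_def)
      have "B tagged_partial_division_of cbox a b"
        using ptag by (auto simp: tagged_division_of_def intro: tagged_partial_division_subset[OF _ B(1)])
      then have Btag: "B tagged_division_of \<Union>(snd ` B)"
        by (rule tagged_partial_division_of_Union_self)
      have "(\<Sum>z\<in>B. Sup (snd z) - Inf (snd z)) = (\<Sum>(x, k)\<in>B. measure lebesgue k)"
        unfolding split_def
      proof (rule sum.cong)
        fix z assume "z \<in> B"
        then have "(fst z, snd z) \<in> p" using B(1) by auto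
        from cell[OF this] obtain u v
          where "snd z = {u..v}" "u \<le> v" "Inf (snd z) = u" "Sup (snd z) = v"
          by fastforce
        then show "Sup (snd z) - Inf (snd z) = measure lebesgue (snd z)"
          by simp
      qed simp
      \<comment> \<open>Dropping the tags can identify two pairs only if they share a cell with
        empty interior, whose content is 0.\<close>
      also have "\<dots> = (\<Sum>k\<in>snd ` B. measure lebesgue k)"
        by (rule sum.over_tagged_division_lemma[OF Btag]) (simp add: content_eq_0_interior del: content_real_eq_0)
      also have "\<dots> = measure lebesgue (\<Union>(snd ` B))"
        by (rule content_division[OF division_of_tagged_division[OF Btag]])
      also have "\<dots> \<le> measure lebesgue U"
      proof (rule measure_mono_fmeasurable)
        show "\<Union>(snd ` B) \<subseteq> U"
        proof (rule Union_least, elim imageE)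
          fix k z assume "k = snd z" "z \<in> B"
          then show "k \<subseteq> U"
            using cell[of "fst z" "snd z"] dN[of "fst z"] by (auto simp: B_def)
        qed
        show "\<Union>(snd ` B) \<in> sets lebesgue"
          using lmeasurable_division[OF division_of_tagged_division[OF Btag]] by blast
      qed (rule U_lm)
      finally have small: "(\<Sum>z\<in>B. Sup (snd z) - Inf (snd z)) < \<delta>"
        using mU by simp
      have int_B: "interior (snd z) = {Inf (snd z)<..<Sup (snd z)}" if "z \<in> B" for z
      proof -
        have "(fst z, snd z) \<in> p" using B(1) that by auto
        from cell[OF this] obtain u v where "snd z = {u..v}" "Inf (snd z) = u" "Sup (snd z) = v"
          by blast
        then show ?thesis by simp
      qed
      have sumB: "(\<Sum>z\<in>B. norm (f (Sup (snd z)) - f (Inf (snd z)))) < e / 2"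
      proof (rule \<delta>[THEN spec, THEN spec, THEN spec, THEN mp], intro conjI ballI impI B(2) small)
        fix z assume z: "z \<in> B"
        then show "Inf (snd z) \<le> Sup (snd z)" "{Inf (snd z)..Sup (snd z)} \<subseteq> {a..b}"
          using cell[of "fst z" "snd z"] B by auto
        fix w assume w: "w \<in> B" "z \<noteq> w"
        have "interior (snd z) \<inter> interior (snd w) = {}"
          using tagged_division_ofD(5)[OF ptag, of "fst z" "snd z" "fst w" "snd w"] z w B
          by (auto simp: prod_eq_iff)
        then show "{Inf (snd z)<..<Sup (snd z)} \<inter> {Inf (snd w)<..<Sup (snd w)} = {}"
          using int_B z w by simp
      qed
      \<comment> \<open>Every cell is charged \<open>e1\<close> times its length, including those in
        \<open>B\<close> where this is merely harmless, so that these charges add up to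
        \<open>e1 * (b - a)\<close>.\<close>
      have "norm (\<Sum>(x, K) \<in> p. (measure lborel K *\<^sub>R h x) - (f (Sup K) - f (Inf K)))
          \<le> (\<Sum>z\<in>p. (if z \<in> B then norm (f (Sup (snd z)) - f (Inf (snd z))) else 0)
                + e1 * (Sup (snd z) - Inf (snd z)))"
      proof (rule sum_norm_le, safe)
        fix t K
        assume tK: "(t, K) \<in> p"
        from cell[OF this] obtain u v where K: "K = {u..v}" and uv: "u \<le> t" "t \<le> v"
          "{u..v} \<subseteq> {a..b}" "{u..v} \<subseteq> ball t (d t)" and io: "Inf K = u" "Sup K = v"
          by blast
        show "norm (measure lborel K *\<^sub>R h t - (f (Sup K) - f (Inf K)))
            \<le> (if (t, K) \<in> B then norm (f (Sup (snd (t, K))) - f (Inf (snd (t, K)))) else 0)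
                + e1 * (Sup (snd (t, K)) - Inf (snd (t, K)))"
        proof (cases "t \<in> N")
          case True
          then show ?thesis
            using tK uv \<open>e1 > 0\<close> by (simp add: B_def h_def io norm_minus_commute)
        next
          case False
          then have t: "t \<in> {a..b} - N" using uv by auto
          have uvb: "u \<in> {u..v}" "v \<in> {u..v}" using uv by auto
          have ends: "norm (u - t) < d t" "norm (v - t) < d t"
            using subsetD[OF uv(4) uvb(1)] subsetD[OF uv(4) uvb(2)] by (auto simp: dist_real_def)
          \<comment> \<open>Straddling argument: the increment is split at the tag \<open>t\<close>,
            and since \<open>u \<le> t \<le> v\<close> the two errors add up to
            \<open>e1 * (v - u)\<close> exactly.\<close>
          have "norm ((v - u) *\<^sub>R f' t - (f v - f u))
            = norm (f u - f t - (u - t) *\<^sub>R f' t - (f v - f t - (v - t) *\<^sub>R f' t))"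
            by (auto simp: algebra_simps)
          also have "\<dots> \<le> norm (f u - f t - (u - t) *\<^sub>R f' t) + norm (f v - f t - (v - t) *\<^sub>R f' t)"
            by (rule norm_triangle_ineq4)
          also have "\<dots> \<le> e1 * norm (u - t) + e1 * norm (v - t)"
            using ends uv(3) uvb by (intro add_mono d[OF t]) blast+
          also have "\<dots> = e1 * (v - u)"
            using uv by (simp add: algebra_simps)
          finally show ?thesis
            using False uv by (simp add: B_def h_def io K)
        qed
      qed
      also have "\<dots> = (\<Sum>z\<in>B. norm (f (Sup (snd z)) - f (Inf (snd z)))) + e1 * (b - a)"
        using B fin by (simp add: ba(1) sum.distrib sum_distrib_left sum.If_cases split_def Int_absorb1)
      also have "\<dots> < e"
        using sumB e1 by linarith
      finally show "norm ((\<Sum>(x, k)\<in>p. measure lborel k *\<^sub>R h x) - (f b - f a)) < e"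
        by (simp add: ba(2) split_def sum_subtractf)
    qed
  qed
qed

section \<open>Improper integrals, continuity and convexity\<close>

text \<open>Nonnegativity makes the integrals over \<open>{a..T}\<close> monotone in
  \<open>T\<close>, and the bound beyond \<open>c\<close> keeps them bounded, so they converge to
  their supremum. The resulting gauge integral is absolute by nonnegativity, and continuity supplies
  the Borel measurability needed to pass from \<open>lebesgue\<close> to
  \<open>lborel\<close>.\<close>

lemma set_integrable_atLeast_nonneg_bounded_integrals:
  fixes f :: "real \<Rightarrow> real"
  assumes cont: "continuous_on {a..} f" and nonneg: "\<And>t. t \<ge> a \<Longrightarrow> f t \<ge> 0"
    and "c \<ge> a" and bound: "\<And>T. T \<ge> c \<Longrightarrow> integral {c..T} f \<le> C"
  shows "set_integrable lborel {a..} f"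
proof -
  define F where "F = (\<lambda>T. integral {a..T} f)"
  have int: "f integrable_on {u..T}" if "u \<ge> a" for u T
    using that by (intro integrable_continuous_real continuous_on_subset[OF cont]) auto
  have mono: "F S \<le> F T" if "S \<le> T" for S T
    unfolding F_def using that nonneg by (intro integral_subset_le int) auto
  have bd: "F T \<le> F c + C" for T
  proof -
    \<comment> \<open>Moving up to \<open>max c T\<close> makes the hypothesis on
      \<open>{c..T}\<close> applicable even when \<open>T < c\<close>.\<close>
    have "F T \<le> F (max c T)" by (rule mono) simp
    also have "\<dots> = F c + integral {c..max c T} f"
      unfolding F_def using \<open>c \<ge> a\<close> by (intro Henstock_Kurzweil_Integration.integral_combine[symmetric] int) auto
    also have "\<dots> \<le> F c + C" using bound[of "max c T"] by simp
    finally show ?thesis .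
  qed
  have bdd: "bdd_above (range F)"
    by (rule bdd_aboveI2[OF bd])
  have "(F \<longlongrightarrow> (SUP T. F T)) at_top"
  proof (rule order_tendstoI)
    fix y assume "y < (SUP T. F T)"
    then obtain T where "y < F T"
      using less_cSUP_iff[OF _ bdd] by auto
    then have "y < F S" if "S \<ge> T" for S
      using mono[OF that] by linarith
    then show "\<forall>\<^sub>F S in at_top. y < F S"
      unfolding eventually_at_top_linorder by blast
  next
    fix y assume y: "(SUP T. F T) < y"
    have "F S < y" for S
      using cSUP_upper[OF UNIV_I bdd, of S] y by linarith
    then show "\<forall>\<^sub>F S in at_top. F S < y"
      by simp
  qed
  then have "f integrable_on {a..}"
    unfolding F_def
    using has_integral_to_inf[of f a, OF int[OF order.refl] _ nonneg] by blast
  then have "f absolutely_integrable_on {a..}"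
    by (rule nonnegative_absolutely_integrable_1) (use nonneg in auto)
  moreover have "(\<lambda>t. indicator {a..} t *\<^sub>R f t) \<in> borel_measurable borel"
    by (intro borel_measurable_continuous_on_indicator cont) auto
  ultimately show ?thesis
    by (simp add: set_integrable_def integrable_completion)
qed

text \<open>A family consisting of the one interval between \<open>s\<close> and \<open>t\<close>
  suffices; \<open>min\<close> and \<open>max\<close> put its endpoints in order.\<close>

lemma absolutely_continuous_on_imp_continuous_on:
  fixes f :: "real \<Rightarrow> 'a::real_normed_vector"
  assumes ac: "absolutely_continuous_on {a..b} f"
  shows "continuous_on {a..b} f"
  unfolding continuous_on_iff
proof (intro ballI allI impI)
  fix s e :: real assume s: "s \<in> {a..b}" and "e > 0"
  obtain d where "d > 0" and d: "\<forall>(I :: unit set) u v. finite I \<and> (\<forall>i\<in>I. u i \<le> v i \<and> {u i..v i} \<subseteq> {a..b}) \<and>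
        (\<forall>i\<in>I. \<forall>j\<in>I. i \<noteq> j \<longrightarrow> {u i<..<v i} \<inter> {u j<..<v j} = {}) \<and>
        (\<Sum>i\<in>I. v i - u i) < d \<longrightarrow> (\<Sum>i\<in>I. norm (f (v i) - f (u i))) < e"
    using absolutely_continuous_on_finite_family[OF ac \<open>e > 0\<close>] by blast
  show "\<exists>d>0. \<forall>t\<in>{a..b}. dist t s < d \<longrightarrow> dist (f t) (f s) < e"
  proof (intro exI[of _ d] conjI ballI impI \<open>d > 0\<close>)
    fix t assume "t \<in> {a..b}" "dist t s < d"
    then have "norm (f (max s t) - f (min s t)) < e"
      using d[rule_format, of "{()}" "\<lambda>_. min s t" "\<lambda>_. max s t"] s
      by (auto simp: dist_real_def max_def min_def split: if_splits)
    then show "dist (f t) (f s) < e"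
      by (cases "s \<le> t") (auto simp: dist_norm norm_minus_commute)
  qed
qed

text \<open>Along the line from \<open>y\<close> to \<open>z\<close> the function is convex in one
  real variable, and its tangent at 0 lies below its value at 1.\<close>

lemma convex_on_gradient_inequality:
  fixes g :: "'a::real_inner \<Rightarrow> real"
  assumes g: "convex_on UNIV g" and G: "GDERIV g y :> G"
  shows "g z \<ge> g y + (z - y) \<bullet> G"
proof -
  define \<phi> where "\<phi> s = g (y + s *\<^sub>R (z - y))" for s :: real
  have "\<phi> 1 - \<phi> 0 \<ge> ((z - y) \<bullet> G) * (1 - 0)"
  proof (rule convex_on_imp_above_tangent[where A = UNIV])
    show "convex_on UNIV \<phi>"
    proof (rule convex_onI)
      fix t r s :: real assume t: "0 < t" "t < 1"
      have "\<phi> ((1 - t) *\<^sub>R r + t *\<^sub>R s)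
        = g ((1 - t) *\<^sub>R (y + r *\<^sub>R (z - y)) + t *\<^sub>R (y + s *\<^sub>R (z - y)))"
        unfolding \<phi>_def by (rule arg_cong[of _ _ g]) (simp add: algebra_simps)
      also have "\<dots> \<le> (1 - t) * \<phi> r + t * \<phi> s"
        unfolding \<phi>_def using t by (intro convex_onD[OF g]) auto
      finally show "\<phi> ((1 - t) *\<^sub>R r + t *\<^sub>R s) \<le> (1 - t) * \<phi> r + t * \<phi> s" .
    qed simp
    have "(\<phi> has_derivative (\<lambda>s. (s *\<^sub>R (z - y)) \<bullet> G)) (at 0)"
      unfolding \<phi>_def
      by (rule has_derivative_compose[of "\<lambda>s. y + s *\<^sub>R (z - y)" "\<lambda>s. s *\<^sub>R (z - y)" 0 UNIV g "\<lambda>h. h \<bullet> G"])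
        (use G in \<open>auto simp: gderiv_def intro!: derivative_eq_intros\<close>)
    then show "(\<phi> has_field_derivative (z - y) \<bullet> G) (at 0)"
      by (simp add: has_field_derivative_def mult_commute_abs)
  qed auto
  then show ?thesis by (simp add: \<phi>_def algebra_simps)
qed

section \<open>Regularity of strong solutions\<close>

lemma strong_global_solution_has_vector_derivative:
  assumes sol: "strong_global_solution G \<alpha> \<beta> \<gamma> t\<^sub>0 u\<^sub>0 v\<^sub>0 x"
  shows "\<And>t. t \<ge> t\<^sub>0 \<Longrightarrow> (x has_vector_derivative time_deriv t\<^sub>0 x t) (at t within {t\<^sub>0..})"
    and "continuous_on {t\<^sub>0..} x" "continuous_on {t\<^sub>0..} (time_deriv t\<^sub>0 x)"
proof -
  show x: "(x has_vector_derivative time_deriv t\<^sub>0 x t) (at t within {t\<^sub>0..})" if "t \<ge> t\<^sub>0" for t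
    using sol that
    by (auto simp: strong_global_solution_def time_deriv_def differentiable_on_def
        vector_derivative_works[symmetric])
  then show "continuous_on {t\<^sub>0..} x"
    by (intro continuous_on_vector_derivative) auto
  have "continuous_on {t\<^sub>0..T} (time_deriv t\<^sub>0 x)" if "T > t\<^sub>0" for T
    using sol that
    by (auto simp: strong_global_solution_def locally_absolutely_continuous_from_def
        intro: absolutely_continuous_on_imp_continuous_on)
  \<comment> \<open>Half-open intervals are relatively open in \<open>{t\<^sub>0..}\<close>, so
    continuity within them is continuity within the half-line; at the right end of a closed interval
    it would be one-sided.\<close>
  then have *: "continuous_on {t\<^sub>0..<T} (time_deriv t\<^sub>0 x)" if "T > t\<^sub>0" for T
    using that by (meson atLeastLessThan_subseteq_atLeastAtMost_iff continuous_on_subset order.refl)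
  show "continuous_on {t\<^sub>0..} (time_deriv t\<^sub>0 x)"
    unfolding continuous_on_eq_continuous_within
  proof
    fix t assume t: "t \<in> {t\<^sub>0..}"
    have "continuous (at t within {t\<^sub>0..<t + 1}) (time_deriv t\<^sub>0 x)"
      using *[of "t + 1"] t by (auto simp: continuous_on_eq_continuous_within)
    moreover have "at t within {t\<^sub>0..<t + 1} = at t within {t\<^sub>0..}"
      by (rule at_within_nhd[of _ "{..<t + 1}"]) auto
    ultimately show "continuous (at t within {t\<^sub>0..}) (time_deriv t\<^sub>0 x)"
      by simp
  qed
qed

text \<open>The right-hand side of the equation is continuous in time, so the almost everywhere
  equation integrates to a classical one.\<close>

lemma strong_global_solution_classical:
  assumes sol: "strong_global_solution G \<alpha> \<beta> \<gamma> t\<^sub>0 u\<^sub>0 v\<^sub>0 x"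
    and G: "continuous_on UNIV G" and "t\<^sub>0 > 0" and t: "t \<in> {t\<^sub>0..T}"
  defines "v \<equiv> time_deriv t\<^sub>0 x"
  shows "(v has_vector_derivative
      - ((\<alpha> / t) *\<^sub>R v t) - G (x t + (\<gamma> + \<beta> / t) *\<^sub>R v t)) (at t within {t\<^sub>0..T})"
proof -
  define f where "f t = - ((\<alpha> / t) *\<^sub>R v t) - G (x t + (\<gamma> + \<beta> / t) *\<^sub>R v t)" for t
  have cv: "continuous_on {t\<^sub>0..} v" and cx: "continuous_on {t\<^sub>0..} x"
    using strong_global_solution_has_vector_derivative[OF sol] by (auto simp: v_def)
  have cf: "continuous_on {t\<^sub>0..} f"
    unfolding f_def using \<open>t\<^sub>0 > 0\<close>
    by (intro continuous_intros cv cx continuous_on_compose2[OF G]) auto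
  obtain N where N: "N \<in> null_sets lebesgue"
    and der: "\<And>t. t \<notin> N \<Longrightarrow> t \<ge> t\<^sub>0 \<Longrightarrow> v differentiable (at t within {t\<^sub>0..}) \<and> time_deriv t\<^sub>0 v t = f t"
  proof -
    have "AE t in lebesgue. t \<ge> t\<^sub>0 \<longrightarrow> v differentiable (at t within {t\<^sub>0..}) \<and> time_deriv t\<^sub>0 v t = f t"
      using sol unfolding strong_global_solution_def v_def[symmetric]
      by (auto simp: f_def algebra_simps eq_neg_iff_add_eq_0 elim!: eventually_mono)
    then show ?thesis
      using that by (auto simp: eventually_ae_filter subset_iff)
  qed
  have v_eq: "v u = v t\<^sub>0 + integral {t\<^sub>0..u} f" if "u \<ge> t\<^sub>0" for u
  \<comment> \<open>Local absolute continuity speaks only of intervals with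
    \<open>T > t\<^sub>0\<close>, so the degenerate one is treated apart.\<close>
  proof (cases "u = t\<^sub>0")
    case False
    have "(f has_integral (v u - v t\<^sub>0)) {t\<^sub>0..u}"
    proof (rule absolutely_continuous_on_has_integral_derivative)
      show "absolutely_continuous_on {t\<^sub>0..u} v"
        using sol that False
        by (auto simp: strong_global_solution_def locally_absolutely_continuous_from_def v_def)
      show "negligible N" using N by (simp add: negligible_iff_null_sets)
      fix s assume s: "s \<in> {t\<^sub>0..u} - N"
      then have "(v has_vector_derivative f s) (at s within {t\<^sub>0..})"
        using der[of s] by (auto simp: time_deriv_def vector_derivative_works)
      then show "(v has_vector_derivative f s) (at s within {t\<^sub>0..u})"
        by (rule has_vector_derivative_within_subset) auto
    qed fact
    then show ?thesis by (simp add: integral_unique)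
  qed simp
  have "((\<lambda>u. v t\<^sub>0 + integral {t\<^sub>0..u} f) has_vector_derivative f t) (at t within {t\<^sub>0..T})"
    using integral_has_vector_derivative[of t\<^sub>0 T f t] t continuous_on_subset[OF cf, of "{t\<^sub>0..T}"]
    by (auto intro!: derivative_eq_intros)
  then show ?thesis
    unfolding f_def[symmetric]
    by (rule has_vector_derivative_transform[OF t, rotated]) (rule v_eq, simp)
qed

section \<open>The Lyapunov function and its derivative\<close>

text \<open>Squared norms are written as inner products so that the product rule applies directly.
  The weight of the last term is the one that cancels \<open>(x t - z) \<bullet> v t\<close> in the
  derivative along solutions.\<close>

definition energy ::
    "('a::real_inner \<Rightarrow> real) \<Rightarrow> 'a \<Rightarrow> real \<Rightarrow> real \<Rightarrow> real \<Rightarrow> real \<Rightarrow> (real \<Rightarrow> 'a) \<Rightarrow> (real \<Rightarrow> 'a) \<Rightarrow> real \<Rightarrow> real"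
  where
  "energy g z b \<alpha> \<beta> \<gamma> x v t =
     t\<^sup>2 * (g (x t + (\<gamma> + \<beta> / t) *\<^sub>R v t) - g z)
     + (b *\<^sub>R (x t - z) + t *\<^sub>R v t) \<bullet> (b *\<^sub>R (x t - z) + t *\<^sub>R v t) / 2
     + b * (\<alpha> - 1 - b) / 2 * ((x t - z) \<bullet> (x t - z))"

lemma energy_has_real_derivative:
  fixes x v :: "real \<Rightarrow> 'a::real_inner"
  assumes "t > 0" and G: "GDERIV g (x t + (\<gamma> + \<beta> / t) *\<^sub>R v t) :> G"
    and x: "(x has_vector_derivative v t) (at t within S)"
    and v: "(v has_vector_derivative a) (at t within S)"
  shows "(energy g z b \<alpha> \<beta> \<gamma> x v has_real_derivative
      2 * t * (g (x t + (\<gamma> + \<beta> / t) *\<^sub>R v t) - g z)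
      + t\<^sup>2 * ((v t + (\<gamma> + \<beta> / t) *\<^sub>R a - (\<beta> / t\<^sup>2) *\<^sub>R v t) \<bullet> G)
      + (b *\<^sub>R (x t - z) + t *\<^sub>R v t) \<bullet> (b *\<^sub>R v t + v t + t *\<^sub>R a)
      + b * (\<alpha> - 1 - b) * ((x t - z) \<bullet> v t)) (at t within S)"
proof -
  note x' = x[unfolded has_vector_derivative_def] and v' = v[unfolded has_vector_derivative_def]
  have y: "((\<lambda>t. x t + (\<gamma> + \<beta> / t) *\<^sub>R v t) has_derivative
      (\<lambda>h. h *\<^sub>R (v t + (\<gamma> + \<beta> / t) *\<^sub>R a - (\<beta> / t\<^sup>2) *\<^sub>R v t))) (at t within S)"
    using \<open>t > 0\<close> by (auto intro!: derivative_eq_intros x' v' simp: algebra_simps power2_eq_square)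
  have gy: "((\<lambda>t. g (x t + (\<gamma> + \<beta> / t) *\<^sub>R v t)) has_derivative
      (\<lambda>h. (h *\<^sub>R (v t + (\<gamma> + \<beta> / t) *\<^sub>R a - (\<beta> / t\<^sup>2) *\<^sub>R v t)) \<bullet> G)) (at t within S)"
    by (rule has_derivative_compose[OF y G[unfolded gderiv_def]])
  show ?thesis
    unfolding energy_def has_field_derivative_def
    by (rule derivative_eq_intros gy x' v' refl | simp)+
      (auto simp: fun_eq_iff inner_simps inner_commute power2_eq_square field_simps)
qed

text \<open>This is pure inner-product algebra at a fixed time, with \<open>\<xi>\<close> for
  \<open>x t - z\<close>, \<open>\<Delta>\<close> for \<open>g (y t) - g z\<close> and
  \<open>G\<close> for the gradient. The equation turns \<open>b v + v + t a\<close> into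
  \<open>- (\<alpha> - 1 - b) v - t G\<close>, which yields the velocity damping that later absorbs
  the cross term.\<close>

lemma energy_derivative_le:
  fixes \<xi> v a G :: "'a::real_inner"
  assumes t: "t \<ge> t\<^sub>0" "t\<^sub>0 > 0" and b: "0 < b" "b < \<alpha> - 1"
    and a: "a = - ((\<alpha> / t) *\<^sub>R v) - G"
    and \<Delta>: "\<Delta> \<le> (\<xi> + (\<gamma> + \<beta> / t) *\<^sub>R v) \<bullet> G"
    and M: "M = \<bar>(\<alpha> - b) * \<gamma>\<bar> + \<bar>(\<alpha> + 1 - b) * \<beta>\<bar> / t\<^sub>0"
  shows "2 * t * \<Delta> + t\<^sup>2 * ((v + (\<gamma> + \<beta> / t) *\<^sub>R a - (\<beta> / t\<^sup>2) *\<^sub>R v) \<bullet> G)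
      + (b *\<^sub>R \<xi> + t *\<^sub>R v) \<bullet> (b *\<^sub>R v + v + t *\<^sub>R a) + b * (\<alpha> - 1 - b) * (\<xi> \<bullet> v)
    \<le> - ((b - 2) * (t * \<Delta>)) - (\<gamma> * t\<^sup>2 - (M\<^sup>2 / (4 * (\<alpha> - 1 - b)) + \<bar>\<beta>\<bar>) * t) * (norm G)\<^sup>2"
    (is "?D \<le> ?R")
proof -
  have "t > 0" using t by simp
  define d where "d = \<alpha> - 1 - b"
  have "d > 0" using b by (simp add: d_def)
  \<comment> \<open>The total coefficient of \<open>v \<bullet> G\<close> once convexity has
    replaced \<open>\<xi> \<bullet> G\<close> by \<open>\<Delta>\<close>.\<close>
  define \<kappa> where "\<kappa> = - ((\<alpha> - b) * \<gamma> * t + (\<alpha> + 1 - b) * \<beta>)"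
  \<comment> \<open>The terms \<open>t\<^sup>2 * (v \<bullet> G)\<close> from the potential and the
    kinetic part cancel, as do those in \<open>\<xi> \<bullet> v\<close>; this leaves a coefficient
    of \<open>v \<bullet> G\<close> that is only linear in \<open>t\<close>.\<close>
  have D: "?D = 2 * t * \<Delta> - (\<alpha> * (\<gamma> * t + \<beta>) + \<beta>) * (v \<bullet> G) - (\<gamma> * t\<^sup>2 + \<beta> * t) * (G \<bullet> G)
      - t * d * (v \<bullet> v) - b * t * (\<xi> \<bullet> G)"
    using \<open>t > 0\<close> unfolding a d_def
    by (simp add: inner_simps inner_commute field_simps power2_eq_square)
  have "b * t * \<Delta> \<le> b * t * ((\<xi> + (\<gamma> + \<beta> / t) *\<^sub>R v) \<bullet> G)"
    using \<Delta> b \<open>t > 0\<close> by (intro mult_left_mono) auto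
  also have "\<dots> = b * t * (\<xi> \<bullet> G) + b * (\<gamma> * t + \<beta>) * (v \<bullet> G)"
    using \<open>t > 0\<close> by (simp add: inner_simps field_simps)
  finally have 1: "?D \<le> - ((b - 2) * (t * \<Delta>)) + \<kappa> * (v \<bullet> G) - (\<gamma> * t\<^sup>2 + \<beta> * t) * (G \<bullet> G) - t * d * (v \<bullet> v)"
    unfolding D \<kappa>_def by (simp add: algebra_simps)
  have "\<bar>\<kappa>\<bar> \<le> \<bar>(\<alpha> - b) * \<gamma>\<bar> * t + \<bar>(\<alpha> + 1 - b) * \<beta>\<bar>"
    unfolding \<kappa>_def abs_minus_cancel using \<open>t > 0\<close> abs_triangle_ineq[of "(\<alpha> - b) * \<gamma> * t" "(\<alpha> + 1 - b) * \<beta>"]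
    by (simp add: abs_mult)
  also have "\<dots> \<le> M * t"
  proof -
    \<comment> \<open>Since \<open>t / t\<^sub>0 \<ge> 1\<close>, the constant part of
      \<open>\<kappa>\<close> is absorbed into a multiple of \<open>t\<close>.\<close>
    have "\<bar>(\<alpha> + 1 - b) * \<beta>\<bar> * 1 \<le> \<bar>(\<alpha> + 1 - b) * \<beta>\<bar> * (t / t\<^sub>0)"
      using t by (intro mult_left_mono) auto
    then show ?thesis by (simp add: M algebra_simps)
  qed
  finally have \<kappa>: "\<bar>\<kappa>\<bar> \<le> M * t" .
  have "M \<ge> 0" using t by (simp add: M)
  have "\<kappa> * (v \<bullet> G) \<le> \<bar>\<kappa>\<bar> * \<bar>v \<bullet> G\<bar>"
    by (metis abs_ge_self abs_mult)
  also have "\<dots> \<le> M * t * (norm v * norm G)"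
    using \<kappa> by (intro mult_mono Cauchy_Schwarz_ineq2) auto
  also have "\<dots> \<le> t * (d * (norm v)\<^sup>2 + M\<^sup>2 / (4 * d) * (norm G)\<^sup>2)"
  proof -
    \<comment> \<open>Young's inequality, weighted so that \<open>(norm v)\<^sup>2\<close> gets
      coefficient exactly \<open>d\<close>, which the damping term
      \<open>- t * d * (v \<bullet> v)\<close> cancels.\<close>
    have "0 \<le> (2 * d * norm v - M * norm G)\<^sup>2 / (4 * d)"
      using \<open>d > 0\<close> by simp
    also have "\<dots> = d * (norm v)\<^sup>2 + M\<^sup>2 / (4 * d) * (norm G)\<^sup>2 - M * (norm v * norm G)"
      using \<open>d > 0\<close> by (simp add: field_simps power2_eq_square)
    finally show ?thesis
      using \<open>t > 0\<close> by (simp add: mult.assoc mult.left_commute)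
  qed
  finally have 2: "\<kappa> * (v \<bullet> G) \<le> t * (d * (norm v)\<^sup>2 + M\<^sup>2 / (4 * d) * (norm G)\<^sup>2)" .
  \<comment> \<open>\<open>\<beta>\<close> may have either sign, so its contribution is bounded
    through its absolute value.\<close>
  have 3: "- \<beta> * t * (norm G)\<^sup>2 \<le> \<bar>\<beta>\<bar> * t * (norm G)\<^sup>2"
    using \<open>t > 0\<close> by (intro mult_right_mono) auto
  show ?thesis
    using 1 2 3 unfolding d_def[symmetric] power2_norm_eq_inner by (simp add: algebra_simps)
qed

section \<open>Decay rate and integral estimates\<close>

theorem theorem12:
  fixes g :: "real ^ 'm \<Rightarrow> real" and grad_g :: "real ^ 'm \<Rightarrow> real ^ 'm"
    and x :: "real \<Rightarrow> real ^ 'm" and u\<^sub>0 v\<^sub>0 :: "real ^ 'm"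
    and L\<^sub>g t\<^sub>0 \<alpha> \<beta> \<gamma> :: real
  assumes "convex_on UNIV g"
    and "\<And>z. GDERIV g z :> grad_g z"
    and "L\<^sub>g-lipschitz_on UNIV grad_g"
    and "\<exists>z. is_arg_min g (\<lambda>_. True) z"
    and "t\<^sub>0 > 0" and "\<alpha> > 3" and "\<gamma> > 0"
    and "strong_global_solution grad_g \<alpha> \<beta> \<gamma> t\<^sub>0 u\<^sub>0 v\<^sub>0 x"
  shows "(\<exists>K\<ge>0. \<exists>t\<^sub>1\<ge>t\<^sub>0. \<forall>t\<ge>t\<^sub>1.
            g (x t + (\<gamma> + \<beta> / t) *\<^sub>R time_deriv t\<^sub>0 x t) - (INF z. g z) \<le> K / t\<^sup>2) \<and>
         set_integrable lborel {t\<^sub>0..}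
           (\<lambda>t. t * (g (x t + (\<gamma> + \<beta> / t) *\<^sub>R time_deriv t\<^sub>0 x t) - (INF z. g z))) \<and>
         set_integrable lborel {t\<^sub>0..}
           (\<lambda>t. t\<^sup>2 * (norm (grad_g (x t + (\<gamma> + \<beta> / t) *\<^sub>R time_deriv t\<^sub>0 x t)))\<^sup>2)"
proof -
  obtain z where z: "\<And>w. g z \<le> g w"
    using assms(4) by (auto simp: is_arg_min_linorder)
  have INF: "(INF w. g w) = g z"
    using z by (intro cInf_eq_minimum) auto
  define v where "v = time_deriv t\<^sub>0 x"
  define y where "y t = x t + (\<gamma> + \<beta> / t) *\<^sub>R v t" for t
  define a where "a t = - ((\<alpha> / t) *\<^sub>R v t) - grad_g (y t)" for t
  have cG: "continuous_on UNIV grad_g"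
    using assms(3) by (rule lipschitz_on_continuous_on)
  have cg: "continuous_on UNIV g"
    using assms(2) unfolding gderiv_def
    by (meson continuous_at_imp_continuous_on has_derivative_continuous)
  have x: "(x has_vector_derivative v t) (at t within {t\<^sub>0..T})" if "t \<in> {t\<^sub>0..T}" for t T
    using strong_global_solution_has_vector_derivative(1)[OF assms(8), of t] that
    by (auto simp: v_def intro: has_vector_derivative_within_subset)
  have v: "(v has_vector_derivative a t) (at t within {t\<^sub>0..T})" if "t \<in> {t\<^sub>0..T}" for t T
    unfolding a_def y_def v_def
    by (rule strong_global_solution_classical[OF assms(8) cG \<open>t\<^sub>0 > 0\<close> that])
  have cy: "continuous_on {t\<^sub>0..} y"
    unfolding y_def v_def using \<open>t\<^sub>0 > 0\<close>
    by (intro continuous_intros strong_global_solution_has_vector_derivative[OF assms(8)]) auto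
  define h1 where "h1 t = t * (g (y t) - g z)" for t
  define h2 where "h2 t = t\<^sup>2 * (norm (grad_g (y t)))\<^sup>2" for t
  have ch: "continuous_on {t\<^sub>0..} h1" "continuous_on {t\<^sub>0..} h2"
    unfolding h1_def h2_def
    by (intro continuous_intros continuous_on_compose2[OF cg cy] continuous_on_compose2[OF cG cy] subset_UNIV)+
  have h_nonneg: "h1 t \<ge> 0" "h2 t \<ge> 0" if "t \<ge> t\<^sub>0" for t
    using that z \<open>t\<^sub>0 > 0\<close> by (auto simp: h1_def h2_def)
  \<comment> \<open>The midpoint of the interval from 2 to \<open>\<alpha> - 1\<close>, which is
    nonempty because \<open>\<alpha> > 3\<close>.\<close>
  define b where "b = (\<alpha> + 1) / 2"
  have b: "2 < b" "b < \<alpha> - 1"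
    using \<open>\<alpha> > 3\<close> by (auto simp: b_def)
  define E where "E = energy g z b \<alpha> \<beta> \<gamma> x v"
  define M where "M = \<bar>(\<alpha> - b) * \<gamma>\<bar> + \<bar>(\<alpha> + 1 - b) * \<beta>\<bar> / t\<^sub>0"
  define C where "C = M\<^sup>2 / (4 * (\<alpha> - 1 - b)) + \<bar>\<beta>\<bar>"
  \<comment> \<open>From \<open>2 * C / \<gamma>\<close> on, \<open>C * t\<close> is at most half of
    \<open>\<gamma> * t\<^sup>2\<close>, so half of the gradient term survives.\<close>
  define t\<^sub>1 where "t\<^sub>1 = max t\<^sub>0 (2 * C / \<gamma>)"
  have t1: "t\<^sub>1 \<ge> t\<^sub>0" "2 * C / \<gamma> \<le> t\<^sub>1" by (auto simp: t\<^sub>1_def)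
  \<comment> \<open>The other two summands of the energy are nonnegative since
    \<open>0 < b < \<alpha> - 1\<close>.\<close>
  have E_ge: "t\<^sup>2 * (g (y t) - g z) \<le> E t" for t
    using b by (simp add: E_def energy_def y_def)
  have dE: "\<exists>D. (E has_real_derivative D) (at t within {t\<^sub>1..T}) \<and>
      D \<le> - ((b - 2) * h1 t + \<gamma> / 2 * h2 t)" if t: "t \<in> {t\<^sub>1..T}" for t T
  proof -
    have t': "t \<in> {t\<^sub>0..T}" "t \<ge> t\<^sub>0" "t > 0"
      using t t1 \<open>t\<^sub>0 > 0\<close> by auto
    have sub: "{t\<^sub>1..T} \<subseteq> {t\<^sub>0..T}" using t1 by auto
    have "2 * C / \<gamma> \<le> t"
      using t t1(2) by simp
    then have "C * t \<le> \<gamma> / 2 * t\<^sup>2"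
      using \<open>\<gamma> > 0\<close> \<open>t > 0\<close> by (simp add: field_simps power2_eq_square)
    then have "\<gamma> / 2 * t\<^sup>2 * (norm (grad_g (y t)))\<^sup>2 \<le> (\<gamma> * t\<^sup>2 - C * t) * (norm (grad_g (y t)))\<^sup>2"
      by (intro mult_right_mono) auto
    \<comment> \<open>The gradient inequality at \<open>y t\<close>, tested at the minimiser
      \<open>z\<close>, with \<open>y t - z\<close> expanded; it is the hypothesis on
      \<open>\<Delta>\<close> in the energy estimate.\<close>
    moreover have "g (y t) - g z \<le> (x t - z + (\<gamma> + \<beta> / t) *\<^sub>R v t) \<bullet> grad_g (y t)"
      using convex_on_gradient_inequality[OF assms(1,2), of "y t" z]
      by (simp add: y_def inner_simps algebra_simps)
    note energy_derivative_le[OF t'(2) \<open>t\<^sub>0 > 0\<close> _ b(2) a_def[of t] this M_def]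
    moreover note energy_has_real_derivative[OF \<open>t > 0\<close> assms(2)
        has_vector_derivative_within_subset[OF x[OF t'(1)] sub]
        has_vector_derivative_within_subset[OF v[OF t'(1)] sub],
        where \<beta>=\<beta> and \<gamma>=\<gamma> and z=z and b=b and \<alpha>=\<alpha>]
    ultimately show ?thesis
      using b
      unfolding E_def y_def[symmetric] h1_def h2_def C_def[symmetric]
      by (intro exI conjI) (assumption, simp add: mult.assoc)
  qed
  have decay: "E T + (b - 2) * integral {t\<^sub>1..T} h1 + \<gamma> / 2 * integral {t\<^sub>1..T} h2 \<le> E t\<^sub>1"
    if "T \<ge> t\<^sub>1" for T
  proof -
    have "\<exists>D. \<forall>t\<in>{t\<^sub>1..T}. (E has_real_derivative D t) (at t within {t\<^sub>1..T}) \<and>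
        D t \<le> - ((b - 2) * h1 t + \<gamma> / 2 * h2 t)"
      by (rule bchoice) (blast intro: dE)
    then obtain D where D: "\<And>t. t \<in> {t\<^sub>1..T} \<Longrightarrow> (E has_real_derivative D t) (at t within {t\<^sub>1..T})"
      "\<And>t. t \<in> {t\<^sub>1..T} \<Longrightarrow> D t \<le> - ((b - 2) * h1 t + \<gamma> / 2 * h2 t)"
      by blast
    \<comment> \<open>The fundamental theorem also provides integrability of \<open>D\<close>, which
      is known only pointwise from the choice above.\<close>
    have "(D has_integral (E T - E t\<^sub>1)) {t\<^sub>1..T}"
      using D(1) that
      by (intro fundamental_theorem_of_calculus) (auto simp: has_real_derivative_iff_has_vector_derivative)
    moreover have "h1 integrable_on {t\<^sub>1..T}" "h2 integrable_on {t\<^sub>1..T}"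
      using t1 by (auto intro!: integrable_continuous_real intro: continuous_on_subset[OF ch(1)] continuous_on_subset[OF ch(2)])
    then have "((\<lambda>t. - ((b - 2) * h1 t + \<gamma> / 2 * h2 t)) has_integral
        - ((b - 2) * integral {t\<^sub>1..T} h1 + \<gamma> / 2 * integral {t\<^sub>1..T} h2)) {t\<^sub>1..T}"
      by (intro has_integral_neg has_integral_add has_integral_mult_right integrable_integral)
    ultimately have "E T - E t\<^sub>1 \<le> - ((b - 2) * integral {t\<^sub>1..T} h1 + \<gamma> / 2 * integral {t\<^sub>1..T} h2)"
      using D(2) by (rule has_integral_le)
    then show ?thesis by simp
  qed
  have int_nonneg: "integral {t\<^sub>1..T} h1 \<ge> 0" "integral {t\<^sub>1..T} h2 \<ge> 0" for T
    using h_nonneg t1 by (auto intro!: integral_nonneg integrable_continuous_real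
        intro: continuous_on_subset[OF ch(1)] continuous_on_subset[OF ch(2)])
  have E_nonneg: "E t \<ge> 0" for t
    using order_trans[OF _ E_ge[of t]] z by simp
  \<comment> \<open>All three terms on the left of \<open>decay\<close> are nonnegative. Each claim
    keeps one of them and drops the other two; here the energy is kept, which gives
    \<open>K = E t\<^sub>1\<close>.\<close>
  have "t\<^sup>2 * (g (y t) - g z) \<le> E t\<^sub>1" if "t \<ge> t\<^sub>1" for t
  proof -
    have "0 \<le> (b - 2) * integral {t\<^sub>1..t} h1" "0 \<le> \<gamma> / 2 * integral {t\<^sub>1..t} h2"
      using int_nonneg b \<open>\<gamma> > 0\<close> by auto
    then show ?thesis using decay[OF that] E_ge[of t] by linarith
  qed
  then have "g (y t) - g z \<le> E t\<^sub>1 / t\<^sup>2" if "t \<ge> t\<^sub>1" for t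
    using that t1 \<open>t\<^sub>0 > 0\<close> by (simp add: field_simps)
  moreover have "set_integrable lborel {t\<^sub>0..} h1"
  proof (rule set_integrable_atLeast_nonneg_bounded_integrals[OF ch(1) h_nonneg(1) t1(1)])
    fix T assume "T \<ge> t\<^sub>1"
    moreover have "0 \<le> \<gamma> / 2 * integral {t\<^sub>1..T} h2"
      using int_nonneg \<open>\<gamma> > 0\<close> by auto
    ultimately have "(b - 2) * integral {t\<^sub>1..T} h1 \<le> E t\<^sub>1"
      using decay[of T] E_nonneg[of T] by linarith
    then show "integral {t\<^sub>1..T} h1 \<le> E t\<^sub>1 / (b - 2)"
      using b by (simp add: field_simps)
  qed
  moreover have "set_integrable lborel {t\<^sub>0..} h2"
  proof (rule set_integrable_atLeast_nonneg_bounded_integrals[OF ch(2) h_nonneg(2) t1(1)])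
    fix T assume "T \<ge> t\<^sub>1"
    moreover have "0 \<le> (b - 2) * integral {t\<^sub>1..T} h1"
      using int_nonneg b by auto
    ultimately have "\<gamma> / 2 * integral {t\<^sub>1..T} h2 \<le> E t\<^sub>1"
      using decay[of T] E_nonneg[of T] by linarith
    then show "integral {t\<^sub>1..T} h2 \<le> E t\<^sub>1 / (\<gamma> / 2)"
      using \<open>\<gamma> > 0\<close> by (simp add: field_simps)
  qed
  ultimately show ?thesis
    using E_nonneg t1(1)
    unfolding INF h1_def h2_def y_def v_def by blast
qed

end
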